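(* Let $\ell$ and $n$ be nonnegative integers and let $b,q$ be nonzero complex numbers such that no zero factor appears in any denominator occurring in the identity below. Then $$\sum_{k=0}^{n}\frac{1}{(q^{2-n}b;q^3)_k}\,\frac{(q^{-n};q)_k(\sqrt b;q)_k(-\sqrt b;q)_k(\sqrt{qb};q)_k(-\sqrt{qb};q)_k}{(q;q)_k(q^\ell b;q)_k}\,q^{(1+\ell)k}$$ $$=\frac{(q^{1-2n}/b;q)_n}{(q^{1-2n}/b;q^3)_n}\sum_{i=0}^{\ell}(-1)^n\,\frac{q^{\{(4+4n+6\ell-6i)i-n-n^2\}/6}}{b^{(n+2i)/3}}\,\frac{q-q^{2i}b}{q-b}\,\frac{(q^{-\ell};q)_i(q^{-n};q)_i(b/q;q)_i}{(q;q)_i(q^\ell b;q)_i(q^{1-n-i}/b;q)_i}\cdot\frac{(q;q^3)_{\frac{n-i}{3}}(q^2;q^3)_{\frac{n-i}{3}}}{(q^{2-2n}/b;q^3)_{\frac{n-i}{3}}(q^{3-2n}/b;q^3)_{\frac{n-i}{3}}}\,\chi(n-i).$$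
   Context: For complex $x,q$ and an integer $m$, the $q$-shifted factorial is $(x;q)_m=\prod_{j=0}^{m-1}(1-xq^j)$ for $m>0$, $(x;q)_0=1$, and $(x;q)_m=1/\prod_{j=m}^{-1}(1-xq^j)$ for $m<0$; $(x;q^3)_m$ is the same with $q$ replaced by $q^3$. For an integer $N$, $\chi(N)=1$ if $3\mid N$ and $\chi(N)=0$ otherwise; a summand containing $\chi(n-i)=0$ is understood to be $0$, so only indices $i$ with $(n-i)/3\in\mathbb Z$ contribute (and for these the exponents of $q$ and $b$ are integers). $\sqrt b$ and $\sqrt{qb}$ denote any fixed square roots of $b$ and $qb$. *)

theory Defs
  imports Complex_Main
begin

text \<open>
  For \<open>m < 0\<close> the symbol is itself a reciprocal. Since \<open>1 / 0 = 0\<close>, the formula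
  \<open>qpoch x q m \<noteq> 0\<close> says, for either sign of \<open>m\<close>, that none of the factors
  \<open>1 - x * q powi j\<close> occurring in the symbol is zero.
\<close>

definition qpoch :: "complex \<Rightarrow> complex \<Rightarrow> int \<Rightarrow> complex" where
  "qpoch x q m =
     (if m \<ge> 0 then \<Prod>j = 0..m - 1. 1 - x * q powi j
      else 1 / (\<Prod>j = m..-1. 1 - x * q powi j))"

text \<open>
  For \<open>m \<ge> 0\<close> the range of \<open>j\<close> is empty and the condition is vacuous.
\<close>

definition qpoch_defined :: "complex \<Rightarrow> complex \<Rightarrow> int \<Rightarrow> bool" where
  "qpoch_defined x q m \<longleftrightarrow> (\<forall>j\<in>{m..-1}. 1 - x * q powi j \<noteq> 0)"

definition chi :: "int \<Rightarrow> complex" where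
  "chi N = (if 3 dvd N then 1 else 0)"

end

theory Submission
  imports Defs
begin

text \<open>
  The four square-root factors multiply to \<open>(b;q)\<^sub>2\<^sub>k\<close>. With \<open>X = q\<^sup>l\<close>, the limit
  \<open>d \<rightarrow> 0\<close> of the terminating very-well-poised \<open>\<^sub>6\<phi>\<^sub>5\<close> sum with \<open>a = b/q\<close> expands
  \<open>X\<^sup>k (b;q)\<^sub>2\<^sub>k / (X b;q)\<^sub>k\<close> over \<open>i \<le> k\<close>; cleared of denominators this is a polynomial
  identity in \<open>X\<close> and \<open>b\<close>. Exchanging the two summations leaves inner sums over \<open>j = k - i\<close>, each an
  instance of the case \<open>l = 0\<close> with \<open>n\<close> replaced by \<open>n - i\<close> and \<open>b\<close> by \<open>q\<^sup>2\<^sup>i b\<close>. That cubic sum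
  \<open>S\<^sub>N(C)\<close>, with \<open>C = q\<^sup>-\<^sup>N b\<close>, satisfies a two-term recurrence between \<open>S\<^sub>N\<^sub>+\<^sub>3(C)\<close> and
  \<open>S\<^sub>N(C q\<^sup>3)\<close>, proved by telescoping, so it vanishes unless \<open>3\<close> divides \<open>N\<close> and is a
  product otherwise.
\<close>

section \<open>Finite \<open>q\<close>-shifted factorials with a natural-number index\<close>

definition qp :: "complex \<Rightarrow> complex \<Rightarrow> nat \<Rightarrow> complex" where
  "qp x p n = (\<Prod>j<n. 1 - x * p ^ j)"

lemma qp_0 [simp]: "qp x p 0 = 1"
  by (simp add: qp_def)

lemma qp_Suc: "qp x p (Suc n) = qp x p n * (1 - x * p ^ n)"
  by (simp add: qp_def)

lemma qp_add: "qp x p (m + n) = qp x p m * qp (x * p ^ m) p n"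
  by (induction n) (simp_all add: qp_Suc power_add algebra_simps)

lemma qp_Suc_left: "qp x p (Suc n) = (1 - x) * qp (x * p) p n"
  using qp_add[of x p 1 n] by (simp add: qp_def)

lemma qp_eq_0_iff: "qp x p n = 0 \<longleftrightarrow> (\<exists>j<n. x * p ^ j = 1)"
  by (auto simp: qp_def)

lemma qp_nonzero_le: "qp x p n \<noteq> 0 \<Longrightarrow> m \<le> n \<Longrightarrow> qp x p m \<noteq> 0"
  by (meson order_less_le_trans qp_eq_0_iff)

lemma power_neq_1_of_qp: "qp q q n \<noteq> 0 \<Longrightarrow> 0 < m \<Longrightarrow> m \<le> n \<Longrightarrow> q ^ m \<noteq> 1"
  by (cases m) (auto simp: qp_eq_0_iff)

section \<open>The cubic sum, that is, the case \<open>l = 0\<close>\<close>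

text \<open>
  The denominator \<open>(q\<^sup>2\<^sup>-\<^sup>N b; q\<^sup>3)\<^sub>j\<close> does not depend on \<open>N\<close> once the sum is
  parametrised by \<open>C = q\<^sup>-\<^sup>N b\<close>.
\<close>

definition cubic_term :: "complex \<Rightarrow> nat \<Rightarrow> complex \<Rightarrow> nat \<Rightarrow> complex" where
  "cubic_term q N C j = qp (1 / q ^ N) q j * qp (C * q ^ (N + j)) q j * q ^ j
     / (qp (q\<^sup>2 * C) (q ^ 3) j * qp q q j)"

definition cubic_sum :: "complex \<Rightarrow> nat \<Rightarrow> complex \<Rightarrow> complex" where
  "cubic_sum q N C = (\<Sum>j\<le>N. cubic_term q N C j)"

lemma cubic_term_Suc:
  assumes qq: "qp q q (Suc j) \<noteq> 0"
    and D: "qp (q\<^sup>2 * C) (q ^ 3) (Suc j) \<noteq> 0"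
  shows "cubic_term q M C (Suc j) * (1 - q ^ Suc j) * (1 - C * q ^ M * q ^ j) * (1 - C * q\<^sup>2 * (q ^ j) ^ 3)
       = cubic_term q M C j * (1 - q ^ j / q ^ M) * q
         * ((1 - C * q ^ M * (q ^ j)\<^sup>2) * (1 - C * q ^ M * (q ^ j)\<^sup>2 * q))"
proof -
  \<comment> \<open>The base point \<open>C q^(M+j)\<close> moves with \<open>j\<close>, so passing
    to \<open>Suc j\<close> drops one factor at the front and gains two at the end.\<close>
  have "(1 - C * q ^ M * q ^ j) * qp (C * q ^ (M + Suc j)) q (Suc j) = qp (C * q ^ (M + j)) q (j + 2)"
    using qp_Suc_left[of "C * q ^ (M + j)" q "Suc j"] by (simp add: power_add mult_ac)
  also have "\<dots> = qp (C * q ^ (M + j)) q j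
      * ((1 - C * q ^ M * (q ^ j)\<^sup>2) * (1 - C * q ^ M * (q ^ j)\<^sup>2 * q))"
    by (simp add: qp_Suc power_add power2_eq_square mult_ac)
  finally have E: "(1 - C * q ^ M * q ^ j) * qp (C * q ^ (M + Suc j)) q (Suc j) = \<dots>" .
  have d: "qp (q\<^sup>2 * C) (q ^ 3) (Suc j) = qp (q\<^sup>2 * C) (q ^ 3) j * (1 - C * q\<^sup>2 * (q ^ j) ^ 3)"
    by (simp add: qp_Suc mult_ac power_mult[symmetric])
  have e: "qp q q (Suc j) = qp q q j * (1 - q ^ Suc j)"
    by (simp add: qp_Suc)
  have nz: "1 - C * q\<^sup>2 * (q ^ j) ^ 3 \<noteq> 0" "1 - q ^ Suc j \<noteq> 0"
      "qp (q\<^sup>2 * C) (q ^ 3) j \<noteq> 0" "qp q q j \<noteq> 0"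
    using D qq d e by auto
  have "cubic_term q M C (Suc j) * (1 - q ^ Suc j) * (1 - C * q ^ M * q ^ j) * (1 - C * q\<^sup>2 * (q ^ j) ^ 3)
    = qp (1 / q ^ M) q (Suc j) * ((1 - C * q ^ M * q ^ j) * qp (C * q ^ (M + Suc j)) q (Suc j)) * q ^ Suc j
       / (qp (q\<^sup>2 * C) (q ^ 3) j * qp q q j)"
    unfolding cubic_term_def d e using nz by (simp add: divide_simps del: power_Suc)
  also have "\<dots> = cubic_term q M C j * (1 - q ^ j / q ^ M) * q
         * ((1 - C * q ^ M * (q ^ j)\<^sup>2) * (1 - C * q ^ M * (q ^ j)\<^sup>2 * q))"
    unfolding E cubic_term_def by (simp add: qp_Suc)
  finally show ?thesis .
qed

text \<open>
  Found by Gosper's algorithm, with \<open>y = q\<^sup>j\<close> and \<open>z = q\<^sup>M\<close>; the antidifference is the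
  Laurent multiple \<open>(1 - y) (q - C z y) z / y\<close> of the summand.
\<close>

lemma cubic_certificate:
  fixes C q y z :: complex
  shows "q * (z - y) * ((1 - C * z * y\<^sup>2) * (1 - C * z * y\<^sup>2 * q))
      - (1 - y) * (q - C * z * y) * z * (1 - C * q\<^sup>2 * y ^ 3)
    = y * ((z - 1) * (q - C * z\<^sup>2) * (1 - C * q\<^sup>2 * y ^ 3)
      + C * (z - y) * (z - y * q) * (z - y * q\<^sup>2))"
  by (simp add: algebra_simps power2_eq_square power3_eq_cube)

text \<open>By \<open>cubic_certificate\<close>, \<open>(z - 1) (q - C z^2)\<close> times a summand
  is a difference of \<open>G\<close> minus a remainder \<open>r\<close> with three extra linear
  factors. Summing differences over \<open>j < M\<close> is enough: \<open>G 0 = 0\<close>, and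
  \<open>G M\<close> supplies the summand \<open>j = M\<close>.\<close>

lemma cubic_telescope:
  fixes M :: nat and q C :: complex
  defines "z \<equiv> q ^ M"
  assumes q: "q \<noteq> 0" and qq: "qp q q M \<noteq> 0" and D: "qp (q\<^sup>2 * C) (q ^ 3) M \<noteq> 0"
  shows "(z - 1) * (q - C * z\<^sup>2) * cubic_sum q M C
       = - (\<Sum>j<M. C * (z - q ^ j) * (z - q ^ j * q) * (z - q ^ j * q\<^sup>2)
              * cubic_term q M C j / (1 - C * q\<^sup>2 * (q ^ j) ^ 3))"
proof -
  define p where "p = (z - 1) * (q - C * z\<^sup>2)"
  define G where "G = (\<lambda>j. cubic_term q M C j * (1 - q ^ j) * (q - C * z * q ^ j) * z / q ^ j)"
  define r where "r = (\<lambda>j. C * (z - q ^ j) * (z - q ^ j * q) * (z - q ^ j * q\<^sup>2)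
              * cubic_term q M C j / (1 - C * q\<^sup>2 * (q ^ j) ^ 3))"
  have z: "z \<noteq> 0" using q by (simp add: z_def)
  have step: "p * cubic_term q M C j + r j = G (Suc j) - G j" if "j < M" for j
  proof -
    define y where "y = q ^ j"
    define F where "F = cubic_term q M C j"
    define d where "d = 1 - C * q\<^sup>2 * y ^ 3"
    have y: "y \<noteq> 0" using q by (simp add: y_def)
    have D': "qp (q\<^sup>2 * C) (q ^ 3) (Suc j) \<noteq> 0" and qq': "qp q q (Suc j) \<noteq> 0"
      using qp_nonzero_le[OF D] qp_nonzero_le[OF qq] that by auto
    have d: "d \<noteq> 0"
      using D' by (simp add: qp_Suc d_def y_def mult_ac power_mult[symmetric])
    have "cubic_term q M C (Suc j) * (1 - q * y) * (1 - C * z * y) * d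
      = F * (1 - y / z) * q * ((1 - C * z * y\<^sup>2) * (1 - C * z * y\<^sup>2 * q))"
      using cubic_term_Suc[OF qq' D', of M] by (simp add: y_def z_def F_def d_def)
    then have "cubic_term q M C (Suc j) * (1 - q * y) * (1 - C * z * y)
      = F * (1 - y / z) * q * ((1 - C * z * y\<^sup>2) * (1 - C * z * y\<^sup>2 * q)) / d"
      using d by (simp add: eq_divide_eq)
    moreover have "G (Suc j) = (cubic_term q M C (Suc j) * (1 - q * y) * (1 - C * z * y)) * z / y"
      using q by (simp add: G_def y_def field_simps)
    ultimately have "G (Suc j)
      = F / (d * y) * (q * ((1 - y / z) * z) * ((1 - C * z * y\<^sup>2) * (1 - C * z * y\<^sup>2 * q)))"
      by (simp add: mult_ac)
    moreover have "(1 - y / z) * z = z - y" using z by (simp add: field_simps)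
    ultimately have G1: "G (Suc j)
      = F / (d * y) * (q * (z - y) * ((1 - C * z * y\<^sup>2) * (1 - C * z * y\<^sup>2 * q)))"
      by simp
    have G0: "G j = F / (d * y) * ((1 - y) * (q - C * z * y) * z * d)"
      using d by (simp add: G_def F_def y_def)
    have "G (Suc j) - G j = F / (d * y) * (y * (p * d + C * (z - y) * (z - y * q) * (z - y * q\<^sup>2)))"
      unfolding G0 G1 p_def d_def cubic_certificate[symmetric] by (simp only: right_diff_distrib)
    also have "\<dots> = p * F + C * (z - y) * (z - y * q) * (z - y * q\<^sup>2) * F / d"
      using d y by (simp add: field_simps)
    finally show ?thesis by (simp add: r_def F_def y_def d_def)
  qed
  have "(\<Sum>j<M. p * cubic_term q M C j + r j) = (\<Sum>j<M. G (Suc j) - G j)"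
    by (intro sum.cong refl step) auto
  also have "\<dots> = G M"
    by (simp add: sum_lessThan_telescope) (simp add: G_def)
  \<comment> \<open>Here \<open>q ^ j = z\<close>, so the multiplier in \<open>G\<close> collapses
    to \<open>- p\<close>.\<close>
  also have "G M = - p * cubic_term q M C M"
    using z by (simp add: G_def p_def z_def[symmetric] power2_eq_square) (simp add: algebra_simps)
  finally have "p * (\<Sum>j<M. cubic_term q M C j) + (\<Sum>j<M. r j) = - (p * cubic_term q M C M)"
    by (simp only: sum.distrib sum_distrib_left mult_minus_left)
  then have "p * (\<Sum>j<Suc M. cubic_term q M C j) = - (\<Sum>j<M. r j)"
    unfolding sum.lessThan_Suc distrib_left by (simp only: eq_neg_iff_add_eq_0 add_ac)
  then show ?thesis
    by (simp add: cubic_sum_def p_def r_def lessThan_Suc_atMost)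
qed

text \<open>The remainder in \<open>cubic_telescope\<close> is again a cubic sum: its three linear
  factors turn \<open>(q^(-N-3);q)_j\<close> into a multiple of \<open>(q^(-N);q)_j\<close>, and its
  extra denominator factor turns \<open>(q^2 C;q^3)_j\<close> into a multiple of
  \<open>(q^5 C;q^3)_j\<close>, that is, \<open>C\<close> into \<open>C q^3\<close>.\<close>

lemma cubic_sum_rec:
  assumes q: "q \<noteq> 0" and qq: "qp q q (N + 3) \<noteq> 0" and D: "qp (q\<^sup>2 * C) (q ^ 3) (N + 3) \<noteq> 0"
  shows "(q - C * (q ^ (N + 3))\<^sup>2) * (1 - q\<^sup>2 * C) * cubic_sum q (N + 3) C
       = - C * (q ^ (N + 3) - q) * (q ^ (N + 3) - q\<^sup>2) * cubic_sum q N (C * q ^ 3)"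
proof -
  define z where "z = q ^ (N + 3)"
  define r where "r = (\<lambda>j. C * (z - q ^ j) * (z - q ^ j * q) * (z - q ^ j * q\<^sup>2)
              * cubic_term q (N + 3) C j / (1 - C * q\<^sup>2 * (q ^ j) ^ 3))"
  have z: "z \<noteq> 0" using q by (simp add: z_def)
  have z1: "z \<noteq> 1" using power_neq_1_of_qp[OF qq, of "N + 3"] by (simp add: z_def)
  have D1: "1 - q\<^sup>2 * C \<noteq> 0" using D by (auto simp: qp_eq_0_iff dest: spec[of _ 0])
  have rj: "r j = C * (z - 1) * (z - q) * (z - q\<^sup>2) / (1 - q\<^sup>2 * C) * cubic_term q N (C * q ^ 3) j"
    if "j \<le> N" for j
  proof -
    define y where "y = q ^ j"
    define d where "d = 1 - C * q\<^sup>2 * y ^ 3"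
    have nz: "qp (q\<^sup>2 * C) (q ^ 3) (Suc j) \<noteq> 0"
      using qp_nonzero_le[OF D] that by auto
    have s: "qp (q\<^sup>2 * C) (q ^ 3) (Suc j) = qp (q\<^sup>2 * C) (q ^ 3) j * d"
      by (simp add: qp_Suc d_def y_def mult_ac power_mult[symmetric])
    have s': "qp (q\<^sup>2 * C) (q ^ 3) (Suc j) = (1 - q\<^sup>2 * C) * qp (q\<^sup>2 * (C * q ^ 3)) (q ^ 3) j"
      by (simp add: qp_Suc_left mult_ac)
    \<comment> \<open>Three factors are split off at the front and then, below, at the back;
      comparing the two gives \<open>h\<close>.\<close>
    have "qp (1 / z) q (j + 3) = qp (1 / z) q 3 * qp (q ^ 3 / z) q j"
      using qp_add[of "1 / z" q 3 j] by (simp add: add.commute)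
    moreover have "qp (1 / z) q 3 = (1 - 1 / z) * (1 - q / z) * (1 - q\<^sup>2 / z)"
      by (simp add: qp_def numeral_3_eq_3 power2_eq_square)
    moreover have "qp (1 / z) q (j + 3) = qp (1 / z) q j * ((1 - y / z) * (1 - y * q / z) * (1 - y * q\<^sup>2 / z))"
      by (simp add: qp_Suc numeral_3_eq_3 power2_eq_square y_def mult_ac)
    ultimately have h: "qp (1 / z) q j * ((1 - y / z) * (1 - y * q / z) * (1 - y * q\<^sup>2 / z))
       = (1 - 1 / z) * (1 - q / z) * (1 - q\<^sup>2 / z) * qp (q ^ 3 / z) q j" by simp
    have g: "z - t = z * (1 - t / z)" for t using z by (simp add: field_simps)
    have f: "(z - y) * (z - y * q) * (z - y * q\<^sup>2)
        = z ^ 3 * ((1 - y / z) * (1 - y * q / z) * (1 - y * q\<^sup>2 / z))" for y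
      unfolding g[of y] g[of "y * q"] g[of "y * q\<^sup>2"] by (simp only: power3_eq_cube mult_ac)
    have "(z - y) * (z - y * q) * (z - y * q\<^sup>2) * qp (1 / z) q j
       = z ^ 3 * (qp (1 / z) q j * ((1 - y / z) * (1 - y * q / z) * (1 - y * q\<^sup>2 / z)))"
      unfolding f by (simp only: mult_ac)
    then have a: "(z - y) * (z - y * q) * (z - y * q\<^sup>2) * qp (1 / z) q j
       = (z - 1) * (z - q) * (z - q\<^sup>2) * qp (q ^ 3 / z) q j"
      unfolding h using f[of 1] by simp
    have N: "q ^ 3 / z = 1 / q ^ N" using q by (simp add: z_def power_add)
    have e: "C * q ^ (N + 3 + j) = C * q ^ 3 * q ^ (N + j)" by (simp add: power_add mult_ac)
    have "r j = C * ((z - y) * (z - y * q) * (z - y * q\<^sup>2) * qp (1 / z) q j)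
        * qp (C * q ^ (N + 3 + j)) q j * q ^ j / (qp (q\<^sup>2 * C) (q ^ 3) (Suc j) * qp q q j)"
      unfolding s by (simp add: r_def y_def d_def cubic_term_def z_def mult_ac)
    also have "\<dots> = C * (z - 1) * (z - q) * (z - q\<^sup>2) / (1 - q\<^sup>2 * C) * cubic_term q N (C * q ^ 3) j"
      unfolding a s' N e by (simp add: cubic_term_def mult_ac)
    finally show ?thesis .
  qed
  \<comment> \<open>The two top indices drop out because \<open>z - q^j q\<close> vanishes at
    \<open>j = N + 2\<close> and \<open>z - q^j q^2\<close> at \<open>j = N + 1\<close>.\<close>
  have "{..<N+3} = insert (N+2) (insert (N+1) {..N})" by auto
  moreover have "r (N+2) = 0" "r (N+1) = 0"
    by (simp_all add: r_def z_def power_add numeral_3_eq_3 power2_eq_square)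
  ultimately have "(\<Sum>j<N+3. r j) = (\<Sum>j\<le>N. r j)" by simp
  also have "\<dots> = C * (z - 1) * (z - q) * (z - q\<^sup>2) / (1 - q\<^sup>2 * C) * cubic_sum q N (C * q ^ 3)"
    by (simp add: rj cubic_sum_def sum_distrib_left)
  finally have "(z - 1) * (q - C * z\<^sup>2) * cubic_sum q (N + 3) C
      = - (C * (z - 1) * (z - q) * (z - q\<^sup>2) / (1 - q\<^sup>2 * C) * cubic_sum q N (C * q ^ 3))"
    using cubic_telescope[OF q qq D] by (simp add: r_def z_def)
  note rec = this
  have "(z - 1) * ((q - C * z\<^sup>2) * (1 - q\<^sup>2 * C) * cubic_sum q (N + 3) C)
      = (1 - q\<^sup>2 * C) * ((z - 1) * (q - C * z\<^sup>2) * cubic_sum q (N + 3) C)"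
    by (simp only: mult_ac)
  also have "\<dots> = (z - 1) * (- C * (z - q) * (z - q\<^sup>2) * cubic_sum q N (C * q ^ 3))"
    unfolding rec using D1 by simp
  finally have eq: "(z - 1) * ((q - C * z\<^sup>2) * (1 - q\<^sup>2 * C) * cubic_sum q (N + 3) C)
      = (z - 1) * (- C * (z - q) * (z - q\<^sup>2) * cubic_sum q N (C * q ^ 3))" .
  have "z - 1 \<noteq> 0" using z1 by simp
  from mult_left_cancel[OF this, THEN iffD1, OF eq] show ?thesis by (simp only: z_def)
qed

lemma isCont_qp [continuous_intros]: "isCont f x \<Longrightarrow> isCont (\<lambda>x. qp (f x) p n) x"
  unfolding qp_def by (intro continuous_intros)

lemma isCont_cubic_sum:
  assumes qq: "qp q q M \<noteq> 0" and D: "qp (q\<^sup>2 * C) (q ^ 3) M \<noteq> 0"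
  shows "isCont (cubic_sum q M) C"
proof -
  have "isCont (\<lambda>C. \<Sum>j\<in>{..M}. cubic_term q M C j) C"
    unfolding cubic_term_def
    by (intro continuous_intros) (use qp_nonzero_le[OF D] qp_nonzero_le[OF qq] in auto)
  then show ?thesis by (simp add: cubic_sum_def[abs_def])
qed

text \<open>
  The recurrence gives no information at \<open>C q\<^sup>2\<^sup>M\<^sup>-\<^sup>1 = 1\<close>, which the hypotheses allow when
  \<open>3\<close> does not divide \<open>M\<close>; this point is reached by continuity in \<open>C\<close>.
\<close>

lemma cubic_sum_eq_0:
  assumes q: "q \<noteq> 0"
  shows "\<not> 3 dvd M \<Longrightarrow> qp q q M \<noteq> 0 \<Longrightarrow> qp (q\<^sup>2 * C) (q ^ 3) M \<noteq> 0 \<Longrightarrow> cubic_sum q M C = 0"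
proof (induction M arbitrary: C rule: less_induct)
  case (less M)
  note qq = less.prems(2)
  define z where "z = q ^ M"
  have z: "z \<noteq> 0" using q by (simp add: z_def)
  have z1: "z \<noteq> 1" using power_neq_1_of_qp[OF qq, of M] less.prems(1) by (cases M) (auto simp: z_def)
  \<comment> \<open>Stated for every admissible \<open>C\<close>, since the limit argument below
    needs it at the points near the given one.\<close>
  have gen: "(q - C * z\<^sup>2) * cubic_sum q M C = 0" if D: "qp (q\<^sup>2 * C) (q ^ 3) M \<noteq> 0" for C
  proof -
    consider "M = 1" | "M = 2" | N where "M = N + 3"
      using less.prems(1) by (metis One_nat_def add.commute dvd_0_right less_2_cases_iff less_Suc_eq
          linorder_neqE_nat nat_le_iff_add not_less_eq numeral_2_eq_2 numeral_3_eq_3 not_less)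
    then show ?thesis
    proof cases
      \<comment> \<open>For \<open>M = 1\<close> and \<open>M = 2\<close> each remainder summand
        contains the factor \<open>z - q^M = 0\<close>; from \<open>M = 3\<close> on, the recurrence
        and the induction hypothesis apply.\<close>
      case 1
      then show ?thesis using cubic_telescope[OF q qq D] z1 by (simp add: z_def)
    next
      case 2
      then have "(\<Sum>j<M. C * (z - q ^ j) * (z - q ^ j * q) * (z - q ^ j * q\<^sup>2)
              * cubic_term q M C j / (1 - C * q\<^sup>2 * (q ^ j) ^ 3)) = 0"
        by (simp add: z_def numeral_2_eq_2)
      then show ?thesis using cubic_telescope[OF q qq D] z1 by (simp add: z_def)
    next
      case 3
      have "qp (q\<^sup>2 * C) (q ^ 3) (Suc N) \<noteq> 0" "qp q q N \<noteq> 0"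
        using qp_nonzero_le[OF D] qp_nonzero_le[OF qq] 3 by auto
      moreover from this(1) have "qp (q\<^sup>2 * (C * q ^ 3)) (q ^ 3) N \<noteq> 0" "1 - q\<^sup>2 * C \<noteq> 0"
        by (auto simp: qp_Suc_left mult_ac)
      moreover have "\<not> 3 dvd N" using less.prems(1) 3 by (simp add: dvd_add_left_iff)
      ultimately show ?thesis
        using less.IH[of N "C * q ^ 3"] cubic_sum_rec[of q N C] q qq D 3 by (simp add: z_def)
    qed
  qed
  show ?case
  proof (cases "q - C * z\<^sup>2 = 0")
    case False
    then show ?thesis using gen[OF less.prems(3)] by simp
  next
    case True
    have "((\<lambda>C. qp (q\<^sup>2 * C) (q ^ 3) M) \<longlongrightarrow> qp (q\<^sup>2 * C) (q ^ 3) M) (at C)"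
      using isCont_def by (intro isContD continuous_intros)
    then have "\<forall>\<^sub>F C' in at C. qp (q\<^sup>2 * C') (q ^ 3) M \<noteq> 0"
      using less.prems(3) by (rule tendsto_imp_eventually_ne)
    moreover have "\<forall>\<^sub>F C' in at C. C' \<noteq> C" by (simp add: eventually_at_filter)
    ultimately have "\<forall>\<^sub>F C' in at C. cubic_sum q M C' = 0"
    proof eventually_elim
      case (elim C')
      \<comment> \<open>The coefficient is linear in \<open>C'\<close> with its only zero at
        \<open>C\<close>, so it can be cancelled at every other point.\<close>
      have "q - C' * z\<^sup>2 = (C - C') * z\<^sup>2" using True by (simp add: algebra_simps)
      then show ?case using gen[of C'] elim z by simp
    qed
    then have "(cubic_sum q M \<longlongrightarrow> 0) (at C)" by (rule tendsto_eventually)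
    moreover have "(cubic_sum q M \<longlongrightarrow> cubic_sum q M C) (at C)"
      using isCont_cubic_sum[OF qq less.prems(3)] by (simp add: isCont_def)
    ultimately show ?thesis by (metis LIM_unique)
  qed
qed

lemma cubic_sum_triple:
  assumes q: "q \<noteq> 0"
  shows "qp q q (3 * m) \<noteq> 0 \<Longrightarrow> qp (q\<^sup>2 * C) (q ^ 3) (3 * m) \<noteq> 0 \<Longrightarrow>
    cubic_sum q (3 * m) C = (- C) ^ m * q ^ (m * (3 * m + 1) div 2)
      * (qp q (q ^ 3) m * qp (q\<^sup>2) (q ^ 3) m) / qp (q\<^sup>2 * C) (q ^ 3) (2 * m)"
proof (induction m arbitrary: C)
  case 0
  then show ?case by (simp add: cubic_sum_def cubic_term_def)
next
  case (Suc m)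
  define P where "P = qp (q\<^sup>2 * (C * q ^ 3)) (q ^ 3) (2 * m)"
  define e where "e = m * (3 * m + 1) div 2"
  have M: "3 * Suc m = 3 * m + 3" by simp
  note qq = Suc.prems(1)[unfolded M] and D = Suc.prems(2)[unfolded M]
  have "qp (q\<^sup>2 * C) (q ^ 3) (Suc (3 * m)) \<noteq> 0" and q3: "qp q q (3 * m) \<noteq> 0"
    using qp_nonzero_le[OF D] qp_nonzero_le[OF qq] by auto
  then have D3: "qp (q\<^sup>2 * (C * q ^ 3)) (q ^ 3) (3 * m) \<noteq> 0" and D1: "1 - q\<^sup>2 * C \<noteq> 0"
    by (auto simp: qp_Suc_left mult_ac)
  have "qp (q\<^sup>2 * C) (q ^ 3) (Suc (2 * m + 1)) \<noteq> 0" using qp_nonzero_le[OF D] by auto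
  moreover have "q - C * (q ^ (3 * m + 3))\<^sup>2 = q * (1 - q\<^sup>2 * C * (q ^ 3) ^ (2 * m + 1))"
  proof -
    have "(q ^ (3 * m + 3))\<^sup>2 = q * (q\<^sup>2 * (q ^ 3) ^ (2 * m + 1))"
      unfolding power_mult[symmetric] power_add[symmetric] power_Suc[symmetric]
      by (rule arg_cong[where f = "power q"]) simp
    then show ?thesis by (simp add: right_diff_distrib mult_ac)
  qed
  moreover have T: "qp (q\<^sup>2 * C) (q ^ 3) (2 * Suc m)
      = (1 - q\<^sup>2 * C) * P * (1 - q\<^sup>2 * C * (q ^ 3) ^ (2 * m + 1))"
    using qp_Suc_left[of "q\<^sup>2 * C" "q ^ 3" "2 * m"] qp_Suc[of "q\<^sup>2 * C" "q ^ 3" "2 * m + 1"]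
    by (simp add: P_def mult_ac)
  ultimately have nz: "P \<noteq> 0" "1 - q\<^sup>2 * C * (q ^ 3) ^ (2 * m + 1) \<noteq> 0"
    and pz: "q - C * (q ^ (3 * m + 3))\<^sup>2 = q * (1 - q\<^sup>2 * C * (q ^ 3) ^ (2 * m + 1))"
    by auto
  define t where "t = 1 - q\<^sup>2 * C * (q ^ 3) ^ (2 * m + 1)"
  define Q where "Q = qp q (q ^ 3) m * qp (q\<^sup>2) (q ^ 3) m"
  have Q: "qp q (q ^ 3) (Suc m) * qp (q\<^sup>2) (q ^ 3) (Suc m)
      = Q * ((1 - q ^ (3 * m + 1)) * (1 - q ^ (3 * m + 2)))"
    by (simp add: Q_def qp_Suc power_mult[symmetric] power_add mult_ac power2_eq_square)
  have zz: "(q ^ (3 * m + 3) - q) * (q ^ (3 * m + 3) - q\<^sup>2)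
      = q ^ 3 * ((1 - q ^ (3 * m + 1)) * (1 - q ^ (3 * m + 2)))"
    by (simp add: power_add power2_eq_square power3_eq_cube algebra_simps)
  \<comment> \<open>The increment \<open>3m\<close> comes from \<open>(C q^3)^m\<close>, and the
    \<open>2\<close> from \<open>q^3\<close> in \<open>zz\<close> divided by \<open>q\<close> in
    \<open>pz\<close>.\<close>
  have ex: "Suc m * (3 * Suc m + 1) div 2 = e + 3 * m + 2"
  proof -
    have "Suc m * (3 * Suc m + 1) = m * (3 * m + 1) + 2 * (3 * m + 2)" by (simp add: algebra_simps)
    then show ?thesis by (simp add: e_def)
  qed
  define K where "K = (1 - q ^ (3 * m + 1)) * (1 - q ^ (3 * m + 2))"
  define s where "s = 1 - q\<^sup>2 * C"
  have sgn: "(- (C * q ^ 3)) ^ m = (- C) ^ m * q ^ (3 * m)"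
    by (simp add: power_mult power_mult_distrib flip: mult_minus_left)
  have "q * t * s * cubic_sum q (3 * m + 3) C
     = - C * (q ^ 3 * K) * ((- C) ^ m * q ^ (3 * m) * q ^ e * Q / P)"
    using cubic_sum_rec[OF q qq D] Suc.IH[OF q3 D3]
    unfolding pz t_def[symmetric] s_def P_def e_def Q_def K_def zz[symmetric] sgn
    by (simp add: mult.assoc)
  moreover have "q * t * s \<noteq> 0" using q nz D1 by (simp add: t_def s_def)
  ultimately have "cubic_sum q (3 * m + 3) C
     = - C * (q ^ 3 * K) * ((- C) ^ m * q ^ (3 * m) * q ^ e * Q / P) / (q * t * s)"
    by (metis nonzero_mult_div_cancel_left)
  also have "\<dots> = - C * (q\<^sup>2 * K) * ((- C) ^ m * q ^ (3 * m) * q ^ e * Q / P) / (t * s)"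
    using q by (simp add: power2_eq_square power3_eq_cube)
  finally have "cubic_sum q (3 * m + 3) C
     = - C * (q\<^sup>2 * K) * ((- C) ^ m * q ^ (3 * m) * q ^ e * Q / P) / (t * s)" .
  then show ?case
    unfolding ex Q T unfolding M t_def[symmetric] s_def[symmetric] K_def[symmetric]
    by (simp add: power_add power2_eq_square mult_ac)
qed

section \<open>Expansion of \<open>X^k (b;q)_(2k)\<close>\<close>

definition qbinom :: "complex \<Rightarrow> nat \<Rightarrow> nat \<Rightarrow> complex" where
  "qbinom q k i = qp q q k / (qp q q i * qp q q (k - i))"

text \<open>
  Equals \<open>(1 - b q\<^sup>2\<^sup>i\<^sup>-\<^sup>1) (b/q;q)\<^sub>i / (1 - b/q)\<close>, in a form that stays meaningful at
  \<open>b = q\<close>.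
\<close>

definition vwp_coeff :: "complex \<Rightarrow> complex \<Rightarrow> nat \<Rightarrow> complex" where
  "vwp_coeff b q i = (case i of 0 \<Rightarrow> 1 | Suc h \<Rightarrow> (1 - b * q ^ (2 * h + 1)) * qp b q h)"

text \<open>This is \<open>X^i (1/X;q)_i\<close> as a polynomial in \<open>X\<close>. At
  \<open>X = q^l\<close> it vanishes for \<open>i > l\<close>, which truncates the final
  sum.\<close>

definition node_prod :: "complex \<Rightarrow> complex \<Rightarrow> nat \<Rightarrow> complex" where
  "node_prod X q i = (\<Prod>j<i. X - q ^ j)"

text \<open>For \<open>i \<le> k\<close> the last two factors are the quotients
  \<open>(b;q)_(2k) / (b;q)_(k+i)\<close> and \<open>(X b;q)_k / (X b;q)_i\<close>, written as
  products so that no denominator involves \<open>X\<close> or \<open>b\<close>.\<close>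

definition expansion_term :: "complex \<Rightarrow> complex \<Rightarrow> complex \<Rightarrow> nat \<Rightarrow> nat \<Rightarrow> complex" where
  "expansion_term X b q k i = qbinom q k i * vwp_coeff b q i * node_prod X q i
     * qp (b * q ^ (k + i)) q (k - i) * qp (X * b * q ^ i) q (k - i)"

text \<open>
  WZ-type certificate for the recurrence in \<open>k\<close>.
\<close>

definition expansion_cert :: "complex \<Rightarrow> complex \<Rightarrow> complex \<Rightarrow> nat \<Rightarrow> nat \<Rightarrow> complex" where
  "expansion_cert X b q k i = (case i of 0 \<Rightarrow> 0 | Suc h \<Rightarrow>
     - (qbinom q k h * qp b q h * node_prod X q (Suc h)
        * qp (b * q ^ (k + 1 + h)) q (k + 1 - h) * qp (X * b * q ^ h) q (k - h)))"

text \<open>The factor \<open>X (1 - b q^(2k)) (1 - b q^(2k+1))\<close> is the ratio of consecutive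
  values of \<open>X^k (b;q)_(2k)\<close>, so summing over \<open>i\<close> shows that the expansion
  obeys the same recurrence.\<close>

lemma expansion_term_rec:
  assumes qq: "qp q q (Suc k) \<noteq> 0" and "i \<le> k"
  shows "expansion_term X b q (Suc k) i
     - X * ((1 - b * q ^ (2 * k)) * (1 - b * q ^ (2 * k + 1))) * expansion_term X b q k i
     = expansion_cert X b q k (Suc i) - expansion_cert X b q k i"
proof (cases i)
  case 0
  have nz: "qp q q k \<noteq> 0" using qp_nonzero_le[OF qq] by auto
  define M where "M = qp (b * q ^ (k + 1)) q (k + 1)"
  have "qp (b * q ^ k) q (k + 2) = (1 - b * q ^ k) * M"
    using qp_Suc_left[of "b * q ^ k" q "k + 1"] by (simp add: M_def mult_ac)
  moreover have "qp (b * q ^ k) q (k + 2)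
      = qp (b * q ^ k) q k * ((1 - b * q ^ (2 * k)) * (1 - b * q ^ (2 * k + 1)))"
    by (simp add: qp_Suc mult_2 power_add mult.assoc)
  ultimately have a: "qp (b * q ^ k) q k * ((1 - b * q ^ (2 * k)) * (1 - b * q ^ (2 * k + 1)))
     = (1 - b * q ^ k) * M" by simp
  have t1: "expansion_term X b q (Suc k) 0 = M * (1 - X * b * q ^ k) * qp (X * b) q k"
    using qq by (simp add: expansion_term_def qbinom_def vwp_coeff_def node_prod_def M_def
        qp_Suc[of "X * b"])
  have t2: "X * ((1 - b * q ^ (2 * k)) * (1 - b * q ^ (2 * k + 1))) * expansion_term X b q k 0
      = X * ((1 - b * q ^ k) * M) * qp (X * b) q k"
    unfolding a[symmetric] using nz
    by (simp add: expansion_term_def qbinom_def vwp_coeff_def node_prod_def)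
  have t3: "expansion_cert X b q k (Suc 0) = - ((X - 1) * M * qp (X * b) q k)"
    using nz by (simp add: expansion_cert_def qbinom_def node_prod_def M_def)
  have t4: "expansion_cert X b q k 0 = 0" by (simp add: expansion_cert_def)
  show ?thesis unfolding 0 t1 t2 t3 t4 by (simp add: algebra_simps)
next
  case (Suc h)
  then obtain w where k: "k = Suc h + w" using assms(2) le_Suc_ex by blast
  define M where "M = qp (b * q ^ (k + Suc (Suc h))) q (w + 1)"
  define Y where "Y = qp (X * b * q ^ Suc h) q w"
  define N where "N = node_prod X q (Suc h)"
  \<comment> \<open>The common part of the \<open>q\<close>-binomials \<open>(k+1, h+1)\<close>,
    \<open>(k, h+1)\<close> and \<open>(k, h)\<close>.\<close>
  define \<beta> where "\<beta> = qp q q k / (qp q q (Suc h) * qp q q (Suc w))"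
  define B where "B = qp b q h"
  define y where "y = q ^ h"
  define v where "v = q ^ w"
  define z where "z = q * y * v"
  have z: "q ^ k = z" by (simp add: k z_def y_def v_def power_add)
  have "qp q q (Suc h) \<noteq> 0" "qp q q (Suc w) \<noteq> 0"
    using qp_nonzero_le[OF qq] k by auto
  then have nz: "qp q q h \<noteq> 0" "1 - q * y \<noteq> 0" "qp q q w \<noteq> 0" "1 - q * v \<noteq> 0"
    by (auto simp: qp_Suc y_def v_def)
  have b1: "qbinom q (Suc k) (Suc h) = \<beta> * (1 - q * z)"
    by (simp add: qbinom_def \<beta>_def k qp_Suc[of q q "Suc (h + w)"] z_def y_def v_def power_add mult_ac)
  have b2: "qbinom q k (Suc h) = \<beta> * (1 - q * v)"
    using nz by (simp add: qbinom_def \<beta>_def k qp_Suc[of q q w] v_def)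
  have b3: "qbinom q k h = \<beta> * (1 - q * y)"
    using nz by (simp add: qbinom_def \<beta>_def k qp_Suc[of q q h] y_def)
  have c: "vwp_coeff b q (Suc h) = (1 - b * q * y\<^sup>2) * B"
    by (simp add: vwp_coeff_def B_def y_def power_mult[symmetric] mult_ac)
  have s1: "qp (b * q ^ (k + Suc h)) q (w + 2) = (1 - b * z * q * y) * M"
    using qp_Suc_left[of "b * q ^ (k + Suc h)" q "w + 1"]
    by (simp add: M_def power_add z y_def mult_ac)
  have s2: "qp (b * q ^ (k + Suc h)) q w * ((1 - b * q ^ (2 * k)) * (1 - b * q ^ (2 * k + 1)))
     = (1 - b * z * q * y) * M"
  proof -
    have "qp x q (w + 2) = qp x q w * ((1 - x * q ^ w) * (1 - x * q ^ w * q))" for x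
      by (simp add: qp_Suc mult_ac)
    moreover have "b * q ^ (k + Suc h) * q ^ w = b * q ^ (2 * k)"
      unfolding mult.assoc power_add[symmetric] by (simp add: k mult_2 add_ac)
    moreover have "b * q ^ (2 * k + 1) = b * q ^ (2 * k) * q" by simp
    ultimately show ?thesis unfolding s1[symmetric] by (simp only:)
  qed
  have s3: "qp (X * b * q ^ Suc h) q (w + 1) = Y * (1 - X * b * z)"
    by (simp add: Y_def qp_Suc z_def y_def v_def mult_ac)
  have s4: "qp (X * b * q ^ h) q (w + 1) = (1 - X * b * y) * Y"
    using qp_Suc_left[of "X * b * q ^ h" q w] by (simp add: Y_def y_def mult_ac)
  have t1: "expansion_term X b q (Suc k) (Suc h)
      = \<beta> * (1 - q * z) * ((1 - b * q * y\<^sup>2) * B) * N * M * (Y * (1 - X * b * z))"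
    unfolding b1[symmetric] c[symmetric] s3[symmetric]
    by (simp add: expansion_term_def N_def M_def k)
  have t2: "X * ((1 - b * q ^ (2 * k)) * (1 - b * q ^ (2 * k + 1))) * expansion_term X b q k (Suc h)
      = X * (\<beta> * (1 - q * v) * ((1 - b * q * y\<^sup>2) * B) * N * ((1 - b * z * q * y) * M) * Y)"
    unfolding b2[symmetric] c[symmetric] s2[symmetric]
    by (simp add: expansion_term_def N_def Y_def k)
  have t3: "expansion_cert X b q k (Suc (Suc h))
      = - (\<beta> * (1 - q * v) * (B * (1 - b * y)) * (N * (X - q * y)) * M * Y)"
    unfolding b2[symmetric]
    by (simp add: expansion_cert_def N_def Y_def M_def B_def qp_Suc[of b] y_def node_prod_def k)
  have t4: "expansion_cert X b q k (Suc h)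
      = - (\<beta> * (1 - q * y) * B * N * ((1 - b * z * q * y) * M) * ((1 - X * b * y) * Y))"
    unfolding b3[symmetric] s1[symmetric] s4[symmetric]
    by (simp add: expansion_cert_def N_def B_def k)
  \<comment> \<open>What remains after the common factor \<open>\<beta> B N M Y\<close> is removed:
    a polynomial identity in \<open>X\<close>, \<open>b\<close>, \<open>q\<close>, \<open>y\<close>,
    \<open>v\<close>.\<close>
  have "(1 - q * z) * (1 - b * q * y\<^sup>2) * (1 - X * b * z)
        - X * (1 - q * v) * (1 - b * q * y\<^sup>2) * (1 - b * z * q * y)
      = - ((1 - q * v) * (1 - b * y) * (X - q * y))
        + (1 - q * y) * (1 - b * z * q * y) * (1 - X * b * y)"
    unfolding z_def by (simp add: algebra_simps power2_eq_square)
  \<comment> \<open>Abstract \<open>a1\<close> to \<open>a9\<close> keep the simplifier from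
    expanding the concrete factors.\<close>
  moreover have "\<beta> * a1 * (a2 * B) * N * M * (Y * a3) - X * (\<beta> * a4 * (a2 * B) * N * (a5 * M) * Y)
      = - (\<beta> * a4 * (B * a6) * (N * a7) * M * Y) - - (\<beta> * a8 * B * N * (a5 * M) * (a9 * Y))"
    if "a1 * a2 * a3 - X * a4 * a2 * a5 = - (a4 * a6 * a7) + a8 * a5 * a9"
    for a1 a2 a3 a4 a5 a6 a7 a8 a9
  proof -
    have "\<beta> * a1 * (a2 * B) * N * M * (Y * a3) - X * (\<beta> * a4 * (a2 * B) * N * (a5 * M) * Y)
      = \<beta> * B * N * M * Y * (a1 * a2 * a3 - X * a4 * a2 * a5)"
      by (simp add: algebra_simps)
    then show ?thesis unfolding that by (simp add: algebra_simps)
  qed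
  ultimately show ?thesis
    unfolding Suc t1 t2 t3 t4 by blast
qed

lemma expansion_sum: "qp q q k \<noteq> 0 \<Longrightarrow> X ^ k * qp b q (2 * k) = (\<Sum>i\<le>k. expansion_term X b q k i)"
proof (induction k)
  case 0
  then show ?case by (simp add: expansion_term_def qbinom_def vwp_coeff_def node_prod_def)
next
  case (Suc k)
  note qq = Suc.prems
  have nz: "qp q q k \<noteq> 0" using qp_nonzero_le[OF qq] by auto
  define F where "F = X * ((1 - b * q ^ (2 * k)) * (1 - b * q ^ (2 * k + 1)))"
  have "(\<Sum>i\<le>k. expansion_term X b q (Suc k) i)
     = (\<Sum>i\<le>k. F * expansion_term X b q k i + (expansion_cert X b q k (Suc i) - expansion_cert X b q k i))"
    using expansion_term_rec[OF qq, of _ X b]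
    by (intro sum.cong refl) (simp add: F_def algebra_simps)
  also have "\<dots> = F * (X ^ k * qp b q (2 * k)) + expansion_cert X b q k (Suc k)"
    unfolding Suc.IH[OF nz] sum.distrib sum_distrib_left
    using sum_lessThan_telescope[of "expansion_cert X b q k" "Suc k"]
    by (simp add: lessThan_Suc_atMost expansion_cert_def)
  \<comment> \<open>The upper boundary value is minus the summand \<open>i = k + 1\<close>, the one
    that the recurrence leaves out.\<close>
  also have "expansion_cert X b q k (Suc k) = - expansion_term X b q (Suc k) (Suc k)"
    using nz qq by (simp add: expansion_cert_def expansion_term_def qbinom_def vwp_coeff_def
        qp_Suc_left[of "b * q ^ (k + k) * q"] qp_Suc_left[of "b * (q * q ^ (k + k))"] mult_2)
  finally have "(\<Sum>i\<le>Suc k. expansion_term X b q (Suc k) i) = F * (X ^ k * qp b q (2 * k))"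
    by simp
  also have "\<dots> = X ^ Suc k * qp b q (2 * Suc k)"
    by (simp add: F_def qp_Suc mult_ac)
  finally show ?case by simp
qed

section \<open>Exchange of the two summations\<close>

text \<open>All symbols of length \<open>i + j\<close> split at \<open>i\<close>. The part depending
  on \<open>j\<close> is a cubic summand because \<open>b q^(2i) = c q^(3i) q^(n-i)\<close>.\<close>

lemma sum_double_term:
  assumes q: "q \<noteq> 0" and qq: "qp q q n \<noteq> 0"
    and X: "qp (X * b) q n \<noteq> 0" and b: "b = c * q ^ n" and le: "i + j \<le> n"
  shows "qp (1 / q ^ n) q (i + j) * q ^ (i + j)
       / (qp (q\<^sup>2 * c) (q ^ 3) (i + j) * qp q q (i + j) * qp (X * b) q (i + j))
       * expansion_term X b q (i + j) i
     = vwp_coeff b q i * node_prod X q i * qp (1 / q ^ n) q i * q ^ i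
       / (qp (X * b) q i * qp q q i * qp (q\<^sup>2 * c) (q ^ 3) i)
       * cubic_term q (n - i) (c * q ^ (3 * i)) j"
proof -
  obtain N where n: "n = i + N" using le le_Suc_ex by (metis add_leD1)
  have "q ^ i / q ^ n = 1 / q ^ N" using q by (simp add: n power_add)
  then have a: "qp (1 / q ^ n) q (i + j) = qp (1 / q ^ n) q i * qp (1 / q ^ N) q j"
    by (simp add: qp_add)
  have d: "qp (q\<^sup>2 * c) (q ^ 3) (i + j)
      = qp (q\<^sup>2 * c) (q ^ 3) i * qp (q\<^sup>2 * (c * q ^ (3 * i))) (q ^ 3) j"
    by (simp add: qp_add power_mult mult.assoc)
  have e: "b * q ^ (i + j + i) = c * q ^ (3 * i) * q ^ (N + j)"
    by (simp add: b n power_add power_mult power3_eq_cube power_mult_distrib mult_ac)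
  have "qp (X * b) q (i + j) \<noteq> 0" "qp q q (i + j) \<noteq> 0"
    using qp_nonzero_le[OF X le] qp_nonzero_le[OF qq le] by auto
  moreover have x: "qp (X * b) q (i + j) = qp (X * b) q i * qp (X * b * q ^ i) q j"
    by (rule qp_add)
  ultimately have nz: "qp (X * b * q ^ i) q j \<noteq> 0" "qp q q (i + j) \<noteq> 0" by auto
  show ?thesis
    unfolding expansion_term_def cubic_term_def qbinom_def a d x e
    using nz by (simp add: n power_add mult_ac)
qed

text \<open>Insert \<open>expansion_sum\<close> and regroup the triangle
  \<open>i + j \<le> n\<close> by \<open>i\<close>; then \<open>j\<close> runs up to
  \<open>n - i\<close>, which is the full range of the inner cubic sum.\<close>

lemma sum_reduction:
  assumes q: "q \<noteq> 0" and qq: "qp q q n \<noteq> 0"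
    and X: "qp (X * b) q n \<noteq> 0" and b: "b = c * q ^ n"
  shows "(\<Sum>k\<le>n. qp (1 / q ^ n) q k * q ^ k
       / (qp (q\<^sup>2 * c) (q ^ 3) k * qp q q k * qp (X * b) q k) * (X ^ k * qp b q (2 * k)))
     = (\<Sum>i\<le>n. vwp_coeff b q i * node_prod X q i * qp (1 / q ^ n) q i * q ^ i
       / (qp (X * b) q i * qp q q i * qp (q\<^sup>2 * c) (q ^ 3) i)
       * cubic_sum q (n - i) (c * q ^ (3 * i)))" (is "?L = (\<Sum>i\<le>n. ?a i * _ i)")
proof -
  define g where "g = (\<lambda>i j. ?a i * cubic_term q (n - i) (c * q ^ (3 * i)) j)"
  have "?L = (\<Sum>k\<le>n. \<Sum>i\<le>k. g i (k - i))"
  proof (intro sum.cong refl)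
    fix k assume "k \<in> {..n}"
    then have "k \<le> n" by simp
    then have "qp q q k \<noteq> 0" using qp_nonzero_le[OF qq] by auto
    note e = expansion_sum[OF this]
    show "qp (1 / q ^ n) q k * q ^ k
       / (qp (q\<^sup>2 * c) (q ^ 3) k * qp q q k * qp (X * b) q k) * (X ^ k * qp b q (2 * k))
       = (\<Sum>i\<le>k. g i (k - i))"
      unfolding e sum_distrib_left
    proof (intro sum.cong refl)
      fix i assume "i \<in> {..k}"
      then obtain j where "k = i + j" by (auto simp: le_iff_add)
      then show "qp (1 / q ^ n) q k * q ^ k
       / (qp (q\<^sup>2 * c) (q ^ 3) k * qp q q k * qp (X * b) q k) * expansion_term X b q k i
         = g i (k - i)"
        using sum_double_term[OF q qq X b, of i j] \<open>k \<le> n\<close> by (simp add: g_def)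
    qed
  qed
  also have "\<dots> = (\<Sum>(i, j)\<in>{(i, j). i + j \<le> n}. g i j)"
    by (rule sum.triangle_reindex_eq[symmetric])
  also have "{(i, j). i + j \<le> n} = (SIGMA i:{..n}. {..n - i})" by auto
  also have "(\<Sum>(i, j)\<in>\<dots>. g i j) = (\<Sum>i\<le>n. \<Sum>j\<le>n - i. g i j)"
    by (simp add: sum.Sigma)
  finally show ?thesis by (simp add: g_def cubic_sum_def sum_distrib_left)
qed

section \<open>Reversal of products and comparison of single terms\<close>

text \<open>Turns the symbols with argument in \<open>1/b\<close> on the right of the theorem into
  symbols in \<open>b\<close>, up to a monomial and a sign.\<close>

lemma qp_reverse:
  assumes "w \<noteq> 0" "p \<noteq> 0"
  shows "qp (p / (w * p ^ K)) p K = (- 1) ^ K / (w ^ K * p ^ (K * (K - 1) div 2)) * qp w p K"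
proof (induction K)
  case (Suc K)
  have "Suc K * K = K * (K - 1) + 2 * K" by (cases K) auto
  then have e: "Suc K * (Suc K - 1) div 2 = K * (K - 1) div 2 + K" by simp
  have "qp (p / (w * p ^ Suc K)) p (Suc K) = (1 - 1 / (w * p ^ K)) * qp (p / (w * p ^ K)) p K"
    using assms by (simp add: qp_Suc_left)
  also have "1 - 1 / (w * p ^ K) = (- 1) * (1 - w * p ^ K) / (w * p ^ K)"
    using assms by (simp add: field_simps)
  finally show ?case
    unfolding Suc.IH e qp_Suc[of w] power_Suc power_add by (simp only: times_divide_times_eq
        times_divide_eq_left times_divide_eq_right divide_divide_eq_left mult_ac)
qed simp

lemma qp_trisect: "qp x q (3 * m) = qp x (q ^ 3) m * qp (x * q) (q ^ 3) m * qp (x * q\<^sup>2) (q ^ 3) m"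
proof (induction m)
  case (Suc m)
  have "3 * Suc m = Suc (Suc (Suc (3 * m)))" by simp
  then show ?case
    by (simp only: qp_Suc Suc.IH) (simp add: power_mult[symmetric] power2_eq_square mult_ac)
qed simp

text \<open>\<open>T\<close> is the exponent produced by \<open>qp_reverse\<close>; the two groups
  on the right are the positive and negative powers of \<open>q\<close> met in
  \<open>term_match\<close>. The proof also shows that the division by \<open>6\<close> is
  exact.\<close>

lemma exponent_identity:
  fixes n i m l :: nat
  assumes n: "n = i + 3 * m"
  defines "T \<equiv> \<lambda>K::nat. K * (K - 1) div 2"
  shows "((4 + 4 * int n + 6 * int l - 6 * int i) * int i - int n - (int n) ^ 2) div 6
    = int (l * i + i + 3 * i * m + m * (3 * m + 1) div 2 + 2 * n * n + n * (i + m))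
    - int (2 * T n + 2 * n + 2 * n * i + T i + m * (4 * n + 2 * i + 1) + 6 * T m)"
proof -
  have T: "2 * int (T K) = int K * int K - int K" for K
  proof -
    have "2 * T K = K * (K - 1)" unfolding T_def by (rule dvd_mult_div_cancel) auto
    then have "2 * int (T K) = int K * int (K - 1)" by (metis of_nat_mult of_nat_numeral)
    then show ?thesis by (cases K) (auto simp: algebra_simps)
  qed
  have "even (m * (3 * m + 1))" by auto
  then have "2 * (m * (3 * m + 1) div 2) = m * (3 * m + 1)" by (rule dvd_mult_div_cancel)
  then have e: "2 * int (m * (3 * m + 1) div 2) = 3 * (int m * int m) + int m"
    by (metis (no_types, lifting) of_nat_mult of_nat_numeral of_nat_add of_nat_1 distrib_left
        mult.left_commute mult.right_neutral)
  \<comment> \<open>The halved quantities become unknowns known only through their doubles, so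
    \<open>div 2\<close> never reaches the ring simplification.\<close>
  have alg: "(4 + 4 * n + 6 * l - 6 * i) * i - n - n ^ 2
      = 6 * ((l * i + i + 3 * i * m + e + 2 * n * n + n * (i + m))
         - (2 * tn + 2 * n + 2 * n * i + ti + m * (4 * n + 2 * i + 1) + 6 * tm))"
    if "2 * e = 3 * (m * m) + m" "2 * tn = n * n - n" "2 * ti = i * i - i" "2 * tm = m * m - m"
      "n = i + 3 * m" for n i m l e tn ti tm :: int
  proof -
    have "6 * ((l * i + i + 3 * i * m + e + 2 * n * n + n * (i + m))
         - (2 * tn + 2 * n + 2 * n * i + ti + m * (4 * n + 2 * i + 1) + 6 * tm))
      = 3 * (2 * e) - 6 * (2 * tn) - 3 * (2 * ti) - 18 * (2 * tm)
        + 6 * ((l * i + i + 3 * i * m + 2 * n * n + n * (i + m))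
         - (2 * n + 2 * n * i + m * (4 * n + 2 * i + 1)))"
      by (simp add: algebra_simps)
    also have "\<dots> = (4 + 4 * n + 6 * l - 6 * i) * i - n - n ^ 2"
      unfolding that(1-4) unfolding that(5) by (simp add: algebra_simps power2_eq_square)
    finally show ?thesis by simp
  qed
  have n': "int n = int i + 3 * int m" using n by simp
  have "(4 + 4 * int n + 6 * int l - 6 * int i) * int i - int n - (int n) ^ 2
    = 6 * (int (l * i + i + 3 * i * m + m * (3 * m + 1) div 2 + 2 * n * n + n * (i + m))
    - int (2 * T n + 2 * n + 2 * n * i + T i + m * (4 * n + 2 * i + 1) + 6 * T m))"
    using alg[OF e T T T n', of "int l"]
    by (simp only: of_nat_add of_nat_mult of_nat_numeral of_nat_1)
  then show ?thesis by simp
qed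

lemma powi_diff_nat: "q \<noteq> 0 \<Longrightarrow> q powi (int a - int d) = q ^ a / q ^ d" for q :: complex
  by (simp add: power_int_diff )

text \<open>After reversal, \<open>(b q^n;q)_n\<close> factors as \<open>Bi P0 P1 P2\<close>. The
  three denominators cancel \<open>Bi\<close>, \<open>P1\<close> and \<open>P0\<close>, while
  \<open>P2\<close> is the tail of \<open>(q^2 c;q^3)_n\<close>; only its head \<open>D2\<close>,
  the left denominator, survives. The rest compares signs and powers of \<open>c\<close> and
  \<open>q\<close>.\<close>

lemma term_match:
  fixes q c b :: complex and n i m l :: nat
  assumes q: "q \<noteq> 0" and c: "c \<noteq> 0" and b: "b = c * q ^ n" and n: "n = i + 3 * m"
    and D: "qp (q\<^sup>2 * c) (q ^ 3) n \<noteq> 0"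
    and z1: "qp (q / (b * q ^ n * q ^ i)) q i \<noteq> 0"
    and z2: "qp (q ^ 3 / (b * q ^ (n + i + 1) * (q ^ 3) ^ m)) (q ^ 3) m \<noteq> 0"
    and z3: "qp (q ^ 3 / (b * q ^ (n + i) * (q ^ 3) ^ m)) (q ^ 3) m \<noteq> 0"
  shows "q ^ (l * i) * q ^ i * ((- (c * q ^ (3 * i))) ^ m * q ^ (m * (3 * m + 1) div 2))
      / (qp (q\<^sup>2 * c) (q ^ 3) i * qp (q\<^sup>2 * (c * q ^ (3 * i))) (q ^ 3) (2 * m))
    = qp (q / (b * q ^ n * q ^ n)) q n / qp (q ^ 3 / (q\<^sup>2 * c * (q ^ 3) ^ n)) (q ^ 3) n
      * ((- 1) ^ n
       * (q powi (((4 + 4 * int n + 6 * int l - 6 * int i) * int i - int n - (int n) ^ 2) div 6)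
          / b ^ (i + m))
       / (qp (q / (b * q ^ n * q ^ i)) q i
          * (qp (q ^ 3 / (b * q ^ (n + i + 1) * (q ^ 3) ^ m)) (q ^ 3) m
             * qp (q ^ 3 / (b * q ^ (n + i) * (q ^ 3) ^ m)) (q ^ 3) m)))"
proof -
  define T where "T = (\<lambda>K::nat. K * (K - 1) div 2)"
  define Bi where "Bi = qp (b * q ^ n) q i"
  define P0 where "P0 = qp (b * q ^ (n + i)) (q ^ 3) m"
  define P1 where "P1 = qp (b * q ^ (n + i + 1)) (q ^ 3) m"
  define P2 where "P2 = qp (b * q ^ (n + i + 2)) (q ^ 3) m"
  define D2 where "D2 = qp (q\<^sup>2 * c) (q ^ 3) (i + 2 * m)"
  define e where "e = m * (3 * m + 1) div 2"
  define u where "u = l * i + i + 3 * i * m + e + 2 * n * n + n * (i + m)"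
  define v where "v = 2 * T n + 2 * n + 2 * n * i + T i + m * (4 * n + 2 * i + 1) + 6 * T m"
  have b0: "b \<noteq> 0" using b c q by simp
  have E: "q powi (((4 + 4 * int n + 6 * int l - 6 * int i) * int i - int n - (int n) ^ 2) div 6)
      = q ^ u / q ^ v"
    unfolding exponent_identity[OF n] u_def v_def T_def e_def by (rule powi_diff_nat[OF q])
  have r1: "qp (q / (b * q ^ n * q ^ n)) q n = (- 1) ^ n / ((b * q ^ n) ^ n * q ^ T n) * (Bi * (P0 * P1 * P2))"
  proof -
    have "qp (b * q ^ n) q n = Bi * (P0 * P1 * P2)"
    proof -
      have "qp (b * q ^ n) q n = Bi * qp (b * q ^ n * q ^ i) q (3 * m)"
        by (simp add: Bi_def n flip: qp_add)
      then show ?thesis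
        unfolding qp_trisect by (simp add: P0_def P1_def P2_def power_add power2_eq_square mult_ac)
    qed
    then show ?thesis using qp_reverse[of "b * q ^ n" q n] q b0 by (simp add: T_def)
  qed
  have Dn: "qp (q\<^sup>2 * c) (q ^ 3) n = D2 * P2"
  proof -
    have "n = (i + 2 * m) + m" using n by simp
    then have "qp (q\<^sup>2 * c) (q ^ 3) n = D2 * qp (q\<^sup>2 * c * (q ^ 3) ^ (i + 2 * m)) (q ^ 3) m"
      unfolding D2_def by (metis qp_add)
    moreover have "q\<^sup>2 * c * (q ^ 3) ^ (i + 2 * m) = b * q ^ (n + i + 2)"
    proof -
      have "q ^ (2 + 3 * (i + 2 * m)) = q ^ (n + (n + i + 2))"
        by (rule arg_cong[where f = "power q"]) (simp add: n)
      then show ?thesis unfolding b power_add power_mult by (simp add: mult_ac)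
    qed
    ultimately show ?thesis by (simp add: P2_def)
  qed
  have r2: "qp (q ^ 3 / (q\<^sup>2 * c * (q ^ 3) ^ n)) (q ^ 3) n
      = (- 1) ^ n / ((q\<^sup>2 * c) ^ n * (q ^ 3) ^ T n) * (D2 * P2)"
    using qp_reverse[of "q\<^sup>2 * c" "q ^ 3" n] q c Dn by (simp add: T_def)
  have r3: "qp (q / (b * q ^ n * q ^ i)) q i = (- 1) ^ i / ((b * q ^ n) ^ i * q ^ T i) * Bi"
    using qp_reverse[of "b * q ^ n" q i] q b0 by (simp add: T_def Bi_def)
  have r4: "qp (q ^ 3 / (b * q ^ (n + i + 1) * (q ^ 3) ^ m)) (q ^ 3) m
      = (- 1) ^ m / ((b * q ^ (n + i + 1)) ^ m * (q ^ 3) ^ T m) * P1"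
    using qp_reverse[of "b * q ^ (n + i + 1)" "q ^ 3" m] q b0 by (simp add: T_def P1_def)
  have r5: "qp (q ^ 3 / (b * q ^ (n + i) * (q ^ 3) ^ m)) (q ^ 3) m
      = (- 1) ^ m / ((b * q ^ (n + i)) ^ m * (q ^ 3) ^ T m) * P0"
    using qp_reverse[of "b * q ^ (n + i)" "q ^ 3" m] q b0 by (simp add: T_def P0_def)
  have nz: "Bi \<noteq> 0" "P0 \<noteq> 0" "P1 \<noteq> 0" "P2 \<noteq> 0" "D2 \<noteq> 0"
    using z1 z2 z3 D unfolding r3 r4 r5 Dn by auto
  have L: "qp (q\<^sup>2 * c) (q ^ 3) i * qp (q\<^sup>2 * (c * q ^ (3 * i))) (q ^ 3) (2 * m) = D2"
    by (simp add: D2_def qp_add power_mult mult.assoc)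
  define lhs_pow where "lhs_pow = q ^ (l * i) * q ^ i * ((c * q ^ (3 * i)) ^ m * q ^ e)"
  \<comment> \<open>Both sides are monomials in \<open>c\<close> and \<open>q\<close>;
    \<open>cp\<close> and \<open>qpw\<close> compare the exponents.\<close>
  have pow: "lhs_pow * ((b * q ^ n) ^ n * q ^ T n * b ^ (i + m) * q ^ v)
     = (q\<^sup>2 * c) ^ n * (q ^ 3) ^ T n * q ^ u * ((b * q ^ n) ^ i * q ^ T i)
       * ((b * q ^ (n + i + 1)) ^ m * (q ^ 3) ^ T m) * ((b * q ^ (n + i)) ^ m * (q ^ 3) ^ T m)"
  proof -
    have cp: "c ^ (m + n + (i + m)) = c ^ (n + i + m + m)" by (simp add: add_ac)
    have qpw: "q ^ (l * i + i + 3 * i * m + e + (n * n + n * n) + T n + n * (i + m) + v)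
       = q ^ (2 * n + 3 * T n + u + (n * i + n * i) + T i + (n * m + (n + i + 1) * m) + 3 * T m
           + (n * m + (n + i) * m) + 3 * T m)"
      by (rule arg_cong[where f = "power q"]) (simp add: u_def v_def algebra_simps)
    have "lhs_pow * ((b * q ^ n) ^ n * q ^ T n * b ^ (i + m) * q ^ v)
      = c ^ (m + n + (i + m)) * q ^ (l * i + i + 3 * i * m + e + (n * n + n * n) + T n + n * (i + m) + v)"
      unfolding lhs_pow_def b power_mult_distrib power_add power_mult[symmetric] distrib_left by (simp only: mult_ac power_add)
    also have "\<dots> = (q\<^sup>2 * c) ^ n * (q ^ 3) ^ T n * q ^ u * ((b * q ^ n) ^ i * q ^ T i)
       * ((b * q ^ (n + i + 1)) ^ m * (q ^ 3) ^ T m) * ((b * q ^ (n + i)) ^ m * (q ^ 3) ^ T m)"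
      unfolding cp qpw unfolding b power_mult_distrib power_mult[symmetric] distrib_right power_add
      by (simp only: mult_ac power_mult_distrib power_mult[symmetric] mult_1_left power_one_right)
    finally show ?thesis .
  qed
  have sgn: "(- 1 :: complex) ^ n = (- 1) ^ i * (- 1) ^ m"
    by (simp add: n power_add power_mult)
  have sq: "(- 1 :: complex) ^ k * (- 1) ^ k = 1" for k by (simp flip: power_mult_distrib)
  define Q1 where "Q1 = (b * q ^ n) ^ n * q ^ T n"
  define Q2 where "Q2 = (q\<^sup>2 * c) ^ n * (q ^ 3) ^ T n"
  define Q3 where "Q3 = (b * q ^ n) ^ i * q ^ T i"
  define Q4 where "Q4 = (b * q ^ (n + i + 1)) ^ m * (q ^ 3) ^ T m"
  define Q5 where "Q5 = (b * q ^ (n + i)) ^ m * (q ^ 3) ^ T m"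
  have Qnz: "Q1 \<noteq> 0" "Q2 \<noteq> 0" "Q3 \<noteq> 0" "Q4 \<noteq> 0" "Q5 \<noteq> 0" "b ^ (i + m) \<noteq> 0" "q ^ v \<noteq> 0"
    using q c b0 by (simp_all add: Q1_def Q2_def Q3_def Q4_def Q5_def)
  have lp: "lhs_pow = Q2 * q ^ u * Q3 * Q4 * Q5 / (Q1 * b ^ (i + m) * q ^ v)"
    using pow Qnz unfolding Q1_def[symmetric] Q2_def[symmetric] Q3_def[symmetric]
      Q4_def[symmetric] Q5_def[symmetric] by (simp add: eq_divide_eq mult_ac)
  have alg: "s * (Q2 * qu * Q3 * Q4 * Q5 / (Q1 * bm * qv)) / D2
     = (sn / Q1 * (Bi * (P0 * P1 * P2))) / (sn / Q2 * (D2 * P2))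
       * (sn * (qu / qv / bm) / ((si / Q3 * Bi) * ((s / Q4 * P1) * (s / Q5 * P0))))"
    if "sn = si * s" "s * s = 1" "si * si = 1" "bm \<noteq> 0" "qv \<noteq> 0" for s si sn qu qv bm :: complex
  proof -
    have nz': "s \<noteq> 0" "si \<noteq> 0" "sn \<noteq> 0" using that by auto
    have h1: "(sn / Q1 * (Bi * (P0 * P1 * P2))) / (sn / Q2 * (D2 * P2)) = Q2 * (Bi * P0 * P1) / (Q1 * D2)"
      using nz nz' Qnz by (simp add: divide_simps)
    have h2: "(si / Q3 * Bi) * ((s / Q4 * P1) * (s / Q5 * P0)) = si * (Bi * P0 * P1) / (Q3 * Q4 * Q5)"
      using that(2) by (simp add: divide_simps)
    have h3: "sn * (qu / qv / bm) / (si * (Bi * P0 * P1) / (Q3 * Q4 * Q5))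
        = s * qu * Q3 * Q4 * Q5 / (qv * bm * (Bi * P0 * P1))"
      using nz' unfolding that(1) by (simp add: mult_ac)
    show ?thesis unfolding h1 h2 h3 using nz by (simp add: mult_ac)
  qed
  have "(- (c * q ^ (3 * i))) ^ m = (- 1) ^ m * (c * q ^ (3 * i)) ^ m"
    by (rule power_minus)
  then have "q ^ (l * i) * q ^ i * ((- (c * q ^ (3 * i))) ^ m * q ^ (m * (3 * m + 1) div 2))
      = (- 1) ^ m * lhs_pow"
    by (simp add: lhs_pow_def e_def)
  then show ?thesis
    unfolding L E r1 r2 r3 r4 r5 lp
    using alg[OF sgn sq sq Qnz(6,7), of "q ^ u"]
    unfolding Q1_def Q2_def Q3_def Q4_def Q5_def by (simp only:)
qed

section \<open>Translation to the symbols of the theorem, and assembly\<close>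

lemma qpoch_of_nat: "qpoch x q (int n) = qp x q n"
proof (induction n)
  case 0
  then show ?case by (simp add: qpoch_def)
next
  case (Suc n)
  have "{0..int (Suc n) - 1} = insert (int n) {0..int n - 1}" by auto
  then show ?case using Suc by (simp add: qpoch_def qp_Suc mult.commute)
qed

text \<open>The pair \<open>sb\<close>, \<open>- sb\<close> gives the even-indexed factors of
  \<open>(b;q)_(2k)\<close>, the pair \<open>sqb\<close>, \<open>- sqb\<close> the odd-indexed
  ones.\<close>

lemma qp_square_roots:
  assumes "sb ^ 2 = b" "sqb ^ 2 = q * b"
  shows "qp sb q k * qp (- sb) q k * qp sqb q k * qp (- sqb) q k = qp b q (2 * k)"
proof (induction k)
  case (Suc k)
  have "(1 - sb * q ^ k) * (1 + sb * q ^ k) = 1 - sb\<^sup>2 * (q ^ k)\<^sup>2"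
    "(1 - sqb * q ^ k) * (1 + sqb * q ^ k) = 1 - sqb\<^sup>2 * (q ^ k)\<^sup>2"
    by (simp_all add: algebra_simps power2_eq_square)
  then have e: "(1 - sb * q ^ k) * (1 + sb * q ^ k) = 1 - b * q ^ (2 * k)"
    "(1 - sqb * q ^ k) * (1 + sqb * q ^ k) = 1 - b * q ^ Suc (2 * k)"
    using assms by (simp_all add: power_mult[symmetric] mult_ac)
  have "qp sb q (Suc k) * qp (- sb) q (Suc k) * qp sqb q (Suc k) * qp (- sqb) q (Suc k)
     = (qp sb q k * qp (- sb) q k * qp sqb q k * qp (- sqb) q k)
       * (((1 - sb * q ^ k) * (1 + sb * q ^ k)) * ((1 - sqb * q ^ k) * (1 + sqb * q ^ k)))"
    by (simp add: qp_Suc mult_ac)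
  then show ?case unfolding e Suc.IH by (simp add: qp_Suc)
qed simp

lemma node_prod_power:
  assumes "q \<noteq> 0"
  shows "node_prod (q ^ l) q i = q ^ (l * i) * qp (1 / q ^ l) q i"
  using assms by (induction i) (simp_all add: node_prod_def qp_Suc power_add field_simps)

lemma vwp_coeff_eq:
  assumes "q \<noteq> 0" "q - b \<noteq> 0"
  shows "vwp_coeff b q i = (q - q ^ (2 * i) * b) / (q - b) * qp (b / q) q i"
proof (cases i)
  case 0
  then show ?thesis using assms by (simp add: vwp_coeff_def)
next
  case (Suc h)
  have "qp (b / q) q (Suc h) = (q - b) / q * qp b q h"
    using assms by (simp add: qp_Suc_left field_simps)
  moreover have "q - q ^ (2 * Suc h) * b = q * (1 - b * q ^ (2 * h + 1))"
    by (simp add: algebra_simps)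
  ultimately show ?thesis using assms Suc by (simp add: vwp_coeff_def)
qed

theorem theorem5:
  fixes l n :: nat and b q sb sqb :: complex
  assumes "b \<noteq> 0" and "q \<noteq> 0"
    and "sb ^ 2 = b" and "sqb ^ 2 = q * b"
    and lhs_denominators: "\<And>k::nat. k \<le> n \<Longrightarrow>
        qpoch (q powi (2 - int n) * b) (q ^ 3) (int k) \<noteq> 0 \<and>
        qpoch q q (int k) \<noteq> 0 \<and>
        qpoch (q ^ l * b) q (int k) \<noteq> 0"
    and prefactor_denominator: "qpoch (q powi (1 - 2 * int n) / b) (q ^ 3) (int n) \<noteq> 0"
    and rhs_denominators: "\<And>i::nat. i \<le> l \<Longrightarrow> 3 dvd (int n - int i) \<Longrightarrow>
        q - b \<noteq> 0 \<and>
        qpoch q q (int i) \<noteq> 0 \<and>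
        qpoch (q ^ l * b) q (int i) \<noteq> 0 \<and>
        qpoch (q powi (1 - int n - int i) / b) q (int i) \<noteq> 0 \<and>
        qpoch_defined q (q ^ 3) ((int n - int i) div 3) \<and>
        qpoch_defined (q ^ 2) (q ^ 3) ((int n - int i) div 3) \<and>
        qpoch (q powi (2 - 2 * int n) / b) (q ^ 3) ((int n - int i) div 3) \<noteq> 0 \<and>
        qpoch (q powi (3 - 2 * int n) / b) (q ^ 3) ((int n - int i) div 3) \<noteq> 0"
  shows
    "(\<Sum>k = 0..n.
        1 / qpoch (q powi (2 - int n) * b) (q ^ 3) (int k)
        * ((qpoch (q powi (- int n)) q (int k)
            * qpoch sb q (int k) * qpoch (- sb) q (int k)
            * qpoch sqb q (int k) * qpoch (- sqb) q (int k))
           / (qpoch q q (int k) * qpoch (q ^ l * b) q (int k)))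
        * q ^ ((1 + l) * k))
     = qpoch (q powi (1 - 2 * int n) / b) q (int n)
       / qpoch (q powi (1 - 2 * int n) / b) (q ^ 3) (int n)
       * (\<Sum>i = 0..l.
           (- 1) ^ n
           * (q powi (((4 + 4 * int n + 6 * int l - 6 * int i) * int i - int n - (int n) ^ 2) div 6)
              / b powi ((int n + 2 * int i) div 3))
           * ((q - q ^ (2 * i) * b) / (q - b))
           * ((qpoch (q powi (- int l)) q (int i)
               * qpoch (q powi (- int n)) q (int i)
               * qpoch (b / q) q (int i))
              / (qpoch q q (int i) * qpoch (q ^ l * b) q (int i)
                 * qpoch (q powi (1 - int n - int i) / b) q (int i)))
           * ((qpoch q (q ^ 3) ((int n - int i) div 3)
               * qpoch (q ^ 2) (q ^ 3) ((int n - int i) div 3))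
              / (qpoch (q powi (2 - 2 * int n) / b) (q ^ 3) ((int n - int i) div 3)
                 * qpoch (q powi (3 - 2 * int n) / b) (q ^ 3) ((int n - int i) div 3)))
           * chi (int n - int i))"
    (is "?L = ?P * (\<Sum>i = 0..l. ?R i)")
proof -
  define c where "c = b / q ^ n"
  have b: "b = c * q ^ n" and c: "c \<noteq> 0"
    using assms(1,2) by (auto simp: c_def)
  note q = assms(2)
  have p0: "q powi (2 - int n) * b = q\<^sup>2 * c"
    using powi_diff_nat[OF q, of 2 n] by (simp add: c_def)
  have pm: "q powi (- int k) = 1 / q ^ k" for k
    by (simp add: power_int_minus inverse_eq_divide)
  have sq: "q ^ (2 * n) = q ^ n * q ^ n" by (simp only: mult_2 power_add)
  have p1: "q powi (1 - 2 * int n) / b = q / (b * q ^ n * q ^ n)"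
    using powi_diff_nat[OF q, of 1 "2 * n"] unfolding sq by (simp add: mult.assoc)
  \<comment> \<open>The same number in the two shapes that \<open>qp_reverse\<close> expects: base
    \<open>q\<close> for the numerator of the prefactor, base \<open>q^3\<close> for its
    denominator.\<close>
  have p1': "q / (b * q ^ n * q ^ n) = q ^ 3 / (q\<^sup>2 * c * (q ^ 3) ^ n)"
  proof -
    have "q ^ 3 / (q\<^sup>2 * c * (q ^ 3) ^ n) = q / (c * (q ^ n * q ^ n * q ^ n))"
      using q by (simp add: power3_eq_cube power2_eq_square power_mult_distrib)
    moreover have "b * q ^ n * q ^ n = c * (q ^ n * q ^ n * q ^ n)"
      unfolding b by (simp only: mult_ac)
    ultimately show ?thesis by (simp only:)
  qed
  have D: "qp (q\<^sup>2 * c) (q ^ 3) n \<noteq> 0" and qq: "qp q q n \<noteq> 0" and X: "qp (q ^ l * b) q n \<noteq> 0"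
    using lhs_denominators[of n] by (auto simp: p0 qpoch_of_nat)
  define A where "A = (\<lambda>i. vwp_coeff b q i * node_prod (q ^ l) q i * qp (1 / q ^ n) q i * q ^ i
       / (qp (q ^ l * b) q i * qp q q i * qp (q\<^sup>2 * c) (q ^ 3) i)
       * cubic_sum q (n - i) (c * q ^ (3 * i)))"
  have "?L = (\<Sum>k\<le>n. qp (1 / q ^ n) q k * q ^ k
       / (qp (q\<^sup>2 * c) (q ^ 3) k * qp q q k * qp (q ^ l * b) q k) * ((q ^ l) ^ k * qp b q (2 * k)))"
    unfolding atLeast0AtMost
  proof (intro sum.cong refl)
    fix k
    have "q ^ ((1 + l) * k) = q ^ k * (q ^ l) ^ k"
      by (simp add: power_add power_mult)
    then show "1 / qpoch (q powi (2 - int n) * b) (q ^ 3) (int k)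
        * ((qpoch (q powi (- int n)) q (int k)
            * qpoch sb q (int k) * qpoch (- sb) q (int k)
            * qpoch sqb q (int k) * qpoch (- sqb) q (int k))
           / (qpoch q q (int k) * qpoch (q ^ l * b) q (int k)))
        * q ^ ((1 + l) * k)
      = qp (1 / q ^ n) q k * q ^ k
       / (qp (q\<^sup>2 * c) (q ^ 3) k * qp q q k * qp (q ^ l * b) q k) * ((q ^ l) ^ k * qp b q (2 * k))"
      unfolding p0 pm qpoch_of_nat qp_square_roots[OF assms(3,4), symmetric] by (simp add: mult_ac)
  qed
  also have "\<dots> = (\<Sum>i\<le>n. A i)"
    unfolding A_def by (rule sum_reduction[OF q qq X b])
  also have "\<dots> = (\<Sum>i = 0..l. ?P * ?R i)"
  \<comment> \<open>The ranges differ, but \<open>A i\<close> vanishes for \<open>i > l\<close>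
    through \<open>node_prod\<close>, and the right-hand summand vanishes for \<open>i > n\<close>
    through \<open>(q^(-n);q)_i\<close>. Hence negative indices \<open>(n - i) div 3\<close> never
    have to be evaluated.\<close>
  proof (rule sum.mono_neutral_cong)
    fix i assume "i \<in> {..n} - {0..l}"
    then have "node_prod (q ^ l) q i = 0"
      by (auto simp: node_prod_def)
    then show "A i = 0" by (simp add: A_def)
  next
    fix i assume "i \<in> {0..l} - {..n}"
    then have "n < i" by auto
    then have "qp (1 / q ^ n) q i = 0"
      using q by (auto simp: qp_eq_0_iff)
    then show "?P * ?R i = 0" by (simp add: pm qpoch_of_nat)
  next
    fix i assume "i \<in> {..n} \<inter> {0..l}"
    then have le: "i \<le> n" "i \<le> l" by auto
    have Dc: "qp (q\<^sup>2 * (c * q ^ (3 * i))) (q ^ 3) (n - i) \<noteq> 0"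
      using qp_add[of "q\<^sup>2 * c" "q ^ 3" i "n - i"] D le by (simp add: power_mult mult.assoc)
    have qi: "qp q q (n - i) \<noteq> 0" using qp_nonzero_le[OF qq] by simp
    show "A i = ?P * ?R i"
    proof (cases "3 dvd (n - i)")
      case False
      have "int n - int i = int (n - i)" using le by linarith
      with False have "\<not> 3 dvd (int n - int i)"
        by (metis int_dvd_int_iff of_nat_numeral)
      then have "chi (int n - int i) = 0" by (simp only: chi_def if_False)
      moreover have "cubic_sum q (n - i) (c * q ^ (3 * i)) = 0"
        by (rule cubic_sum_eq_0[OF q False qi Dc])
      ultimately show ?thesis by (simp add: A_def)
    next
      case True
      then obtain m where m: "n - i = 3 * m" by auto
      then have n: "n = i + 3 * m" using le by simp
      have d: "(int n - int i) div 3 = int m" "3 dvd (int n - int i)" "chi (int n - int i) = 1"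
        using n by (simp_all add: chi_def)
      have bp: "b powi ((int n + 2 * int i) div 3) = b ^ (i + m)"
      proof -
        have "(int n + 2 * int i) div 3 = int (i + m)" using n by simp
        then show ?thesis by (simp only: power_int_of_nat)
      qed
      have p2: "q powi (1 - int n - int i) / b = q / (b * q ^ n * q ^ i)"
        using powi_diff_nat[OF q, of 1 "n + i"] by (simp add: power_add mult_ac diff_diff_eq)
      have e: "(q ^ 3) ^ m * q ^ i = q ^ n" by (simp add: n power_add power_mult)
      have p3: "q powi (3 - 2 * int n) / b = q ^ 3 / (b * q ^ (n + i) * (q ^ 3) ^ m)"
        using powi_diff_nat[OF q, of 3 "2 * n"] unfolding power_add sq
        by (simp add: e[symmetric] mult_ac)
      have p4: "q powi (2 - 2 * int n) / b = q ^ 3 / (b * q ^ (n + i + 1) * (q ^ 3) ^ m)"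
        using powi_diff_nat[OF q, of 2 "2 * n"] q unfolding power_add sq
        by (simp add: e[symmetric] mult_ac power2_eq_square power3_eq_cube)
      note den = rhs_denominators[OF le(2) d(2), unfolded d(1) qpoch_of_nat p2 p3 p4]
      have qb: "q - b \<noteq> 0" using den by simp
      have match: "q ^ (l * i) * q ^ i * ((- (c * q ^ (3 * i))) ^ m * q ^ (m * (3 * m + 1) div 2))
          / (qp (q\<^sup>2 * c) (q ^ 3) i * qp (q\<^sup>2 * (c * q ^ (3 * i))) (q ^ 3) (2 * m))
        = qp (q / (b * q ^ n * q ^ n)) q n / qp (q ^ 3 / (q\<^sup>2 * c * (q ^ 3) ^ n)) (q ^ 3) n
          * ((- 1) ^ n
           * (q powi (((4 + 4 * int n + 6 * int l - 6 * int i) * int i - int n - (int n) ^ 2) div 6)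
              / b ^ (i + m))
           / (qp (q / (b * q ^ n * q ^ i)) q i
              * (qp (q ^ 3 / (b * q ^ (n + i + 1) * (q ^ 3) ^ m)) (q ^ 3) m
                 * qp (q ^ 3 / (b * q ^ (n + i) * (q ^ 3) ^ m)) (q ^ 3) m)))" (is "?l1 = ?pre * (?s / ?t)")
        using term_match[OF q c b n D, of l] den by blast
      \<comment> \<open>The factors shared by both sides once \<open>node_prod\<close> and
        \<open>vwp_coeff\<close> are rewritten; the remaining ones are compared by
        \<open>match\<close>.\<close>
      define W where "W = (q - q ^ (2 * i) * b) / (q - b) * (qp (1 / q ^ l) q i * qp (1 / q ^ n) q i
          * qp (b / q) q i) / (qp (q ^ l * b) q i * qp q q i) * (qp q (q ^ 3) m * qp (q\<^sup>2) (q ^ 3) m)"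
      have "A i = W * ?l1"
        unfolding A_def W_def m
        unfolding cubic_sum_triple[OF q qi[unfolded m] Dc[unfolded m]] vwp_coeff_eq[OF q qb]
          node_prod_power[OF q]
        by (simp add: mult_ac)
      also have "\<dots> = W * (?pre * (?s / ?t))" unfolding match by (rule refl)
      also have "\<dots> = ?P * ?R i"
        unfolding d bp p2 p3 p4 p1 pm qpoch_of_nat p1'[symmetric] W_def by (simp add: mult_ac)
      finally show ?thesis .
    qed
  qed auto
  finally show ?thesis by (simp only: sum_distrib_left)
qed

end
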